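(* For every integer $p\ge 2$, the $\Theta$-graph $\Theta_{p,p+2,p}$ satisfies $\beta(\Theta_{p,p+2,p})=3$.
   Context: For a connected graph $\Gamma$ with vertex set $V(\Gamma)$, $d(u,v)$ is the length (number of edges) of a shortest path between $u$ and $v$. For an ordered set $R=\{w_1,\dots,w_t\}\subseteq V(\Gamma)$, the representation of a vertex $v$ with respect to $R$ is $(d(v,w_1),\dots,d(v,w_t))$. $R$ is a resolving set if distinct vertices have distinct representations with respect to $R$. The metric dimension $\beta(\Gamma)$ is the minimum cardinality of a resolving set of $\Gamma$. For positive integers $a,b,c$ (at most one equal to $1$), the $\Theta$-graph $\Theta_{a,b,c}$ is the graph consisting of two distinct vertices $u,v$ and three internally vertex-disjoint paths between $u$ and $v$ of lengths (numbers of edges) $a$, $b$ and $c$: $u=u_0u_1\cdots u_a=v$, $u=v_0v_1\cdots v_b=v$ and $u=w_0w_1\cdots w_c=v$. No ordering of $a,b,c$ is assumed. *)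

theory Defs
  imports "Graph_Theory.Graph_Theory"
begin

section \<open>Metric dimension\<close>

text \<open>
  Undirected graphs are symmetric digraphs, as in the locale \<^locale>\<open>graph\<close>. The length of a path
  is its number of arcs. For vertices that are not joined by a path \<open>graph_dist\<close> is unspecified,
  so the notions below are meant for connected graphs.
\<close>

definition graph_dist :: "('a, 'b) pre_digraph \<Rightarrow> 'a \<Rightarrow> 'a \<Rightarrow> nat" where
  "graph_dist G x y = (LEAST n. \<exists>q. pre_digraph.apath G x q y \<and> length q = n)"

definition representation :: "('a, 'b) pre_digraph \<Rightarrow> 'a list \<Rightarrow> 'a \<Rightarrow> nat list" where
  "representation G ws x = map (graph_dist G x) ws"

text \<open>Ordered sets of vertices are lists without repetitions.\<close>

definition resolving_set :: "('a, 'b) pre_digraph \<Rightarrow> 'a list \<Rightarrow> bool" where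
  "resolving_set G ws \<longleftrightarrow>
     distinct ws \<and> set ws \<subseteq> verts G \<and> inj_on (representation G ws) (verts G)"

definition metric_dimension :: "('a, 'b) pre_digraph \<Rightarrow> nat" where
  "metric_dimension G = (LEAST t. \<exists>ws. resolving_set G ws \<and> length ws = t)"

section \<open>Theta graphs\<close>

text \<open>
  \<open>theta_path i l k\<close> is the \<open>k\<close>-th vertex of the \<open>i\<close>-th path, where \<open>l\<close> is the length of that path.
  The three paths share exactly their first vertex \<open>Source\<close> and their last vertex \<open>Target\<close>.
\<close>

datatype theta_vertex = Source | Target | Inner nat nat

definition theta_path :: "nat \<Rightarrow> nat \<Rightarrow> nat \<Rightarrow> theta_vertex" where
  "theta_path i l k = (if k = 0 then Source else if k = l then Target else Inner i k)"

definition path_verts :: "nat \<Rightarrow> nat \<Rightarrow> theta_vertex set" where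
  "path_verts i l = {theta_path i l k | k. k \<le> l}"

definition path_arcs :: "nat \<Rightarrow> nat \<Rightarrow> theta_vertex rel" where
  "path_arcs i l =
     {(theta_path i l k, theta_path i l (Suc k)) | k. k < l} \<union>
     {(theta_path i l (Suc k), theta_path i l k) | k. k < l}"

text \<open>The intended parameters are positive, with at most one of them equal to \<open>1\<close>.\<close>

definition theta_graph :: "nat \<Rightarrow> nat \<Rightarrow> nat \<Rightarrow> theta_vertex pair_pre_digraph" where
  "theta_graph a b c =
     \<lparr> pverts = path_verts 0 a \<union> path_verts 1 b \<union> path_verts 2 c,
       parcs = path_arcs 0 a \<union> path_arcs 1 b \<union> path_arcs 2 c \<rparr>"

section \<open>Basic properties\<close>

lemma finite_path_arcs: "finite (path_arcs i l)"
proof -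
  have "path_arcs i l = (\<lambda>k. (theta_path i l k, theta_path i l (Suc k))) ` {..<l} \<union>
      (\<lambda>k. (theta_path i l (Suc k), theta_path i l k)) ` {..<l}"
    by (auto simp: path_arcs_def)
  then show ?thesis by simp
qed

lemma finite_path_verts: "finite (path_verts i l)"
proof -
  have "path_verts i l = theta_path i l ` {..l}" by (auto simp: path_verts_def)
  then show ?thesis by simp
qed

lemma path_arcs_verts: "e \<in> path_arcs i l \<Longrightarrow> fst e \<in> path_verts i l \<and> snd e \<in> path_verts i l"
  unfolding path_arcs_def path_verts_def by (auto intro: Suc_leI less_imp_le)

lemma path_arcs_sym: "(x, y) \<in> path_arcs i l \<Longrightarrow> (y, x) \<in> path_arcs i l"
  unfolding path_arcs_def by auto

lemma path_arcs_loopfree: "e \<in> path_arcs i l \<Longrightarrow> fst e \<noteq> snd e"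
  unfolding path_arcs_def theta_path_def by (auto split: if_splits)

lemma pair_graph_theta_graph: "pair_graph (theta_graph a b c)"
proof
  fix e assume e: "e \<in> parcs (theta_graph a b c)"
  show "fst e \<in> pverts (theta_graph a b c)" "snd e \<in> pverts (theta_graph a b c)"
    using e path_arcs_verts unfolding theta_graph_def by fastforce+
  show "fst e \<noteq> snd e"
    using e path_arcs_loopfree unfolding theta_graph_def by fastforce
next
  show "finite (pverts (theta_graph a b c))" "finite (parcs (theta_graph a b c))"
    by (simp_all add: theta_graph_def finite_path_arcs finite_path_verts)
  show "symmetric (with_proj (theta_graph a b c))"
    by (auto simp: symmetric_def theta_graph_def intro!: symI dest: path_arcs_sym)
qed

lemma connected_theta_graph: "connected (with_proj (theta_graph a b c))"
proof -
  let ?G = "with_proj (theta_graph a b c)"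
  interpret pair_graph "theta_graph a b c" by (rule pair_graph_theta_graph)
  have path: "Source \<rightarrow>\<^sup>*\<^bsub>?G\<^esub> theta_path i l k"
    if "path_arcs i l \<subseteq> parcs (theta_graph a b c)" "k \<le> l" for i l k
    using that(2)
  proof (induction k)
    case 0
    have "Source \<in> pverts (theta_graph a b c)"
      by (auto simp: theta_graph_def path_verts_def theta_path_def)
    then show ?case by (simp add: theta_path_def)
  next
    case (Suc k)
    have "(theta_path i l k, theta_path i l (Suc k)) \<in> path_arcs i l"
      using Suc.prems unfolding path_arcs_def by auto
    then have arc: "(theta_path i l k, theta_path i l (Suc k)) \<in> parcs (theta_graph a b c)"
      using that(1) by (rule rev_subsetD)
    have "Source \<rightarrow>\<^sup>*\<^bsub>?G\<^esub> theta_path i l k"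
      using Suc.prems by (intro Suc.IH) simp
    then show ?case using arc by (rule reachable_adj_trans)
  qed
  have reach: "Source \<rightarrow>\<^sup>*\<^bsub>?G\<^esub> x" if "x \<in> pverts (theta_graph a b c)" for x
  proof -
    have "path_arcs 0 a \<subseteq> parcs (theta_graph a b c)" "path_arcs 1 b \<subseteq> parcs (theta_graph a b c)"
      "path_arcs 2 c \<subseteq> parcs (theta_graph a b c)"
      by (auto simp: theta_graph_def)
    note paths = this[THEN path]
    from that consider k where "x = theta_path 0 a k" "k \<le> a" | k where "x = theta_path 1 b k" "k \<le> b"
      | k where "x = theta_path 2 c k" "k \<le> c"
      by (auto simp: theta_graph_def path_verts_def)
    then show ?thesis by cases (simp_all only: paths)
  qed
  show ?thesis
  proof (rule connectedI)
    show "pverts (theta_graph a b c) \<noteq> {}" by (auto simp: theta_graph_def path_verts_def)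
    fix x y assume "x \<in> pverts (theta_graph a b c)" "y \<in> pverts (theta_graph a b c)"
    then have x: "Source \<rightarrow>\<^sup>*\<^bsub>?G\<^esub> x" and y: "Source \<rightarrow>\<^sup>*\<^bsub>?G\<^esub> y" by (auto intro: reach)
    have "x \<rightarrow>\<^sup>*\<^bsub>?G\<^esub> y"
      by (rule reachable_trans[OF symmetric_reachable[OF sym_arcs x] y])
    then show "x \<rightarrow>\<^sup>*\<^bsub>mk_symmetric ?G\<^esub> y"
      by (rule reachable_mk_symmetricI)
  qed
qed

text \<open>The distance agrees with the weighted shortest-path cost for unit weights.\<close>

lemma (in wf_digraph) graph_dist_eq_unit_cost:
  assumes "x \<rightarrow>\<^sup>* y"
  shows "ereal (real (graph_dist G x y)) = \<mu> (\<lambda>_. 1) x y"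
proof -
  have cost: "awalk_cost (\<lambda>_. 1) q = real (length q)" for q :: "'b list"
    by (induction q) auto
  have "\<exists>n q. apath x q y \<and> length q = n" using assms by (auto simp: reachable_apath)
  then have "\<exists>q. apath x q y \<and> length q = graph_dist G x y"
    unfolding graph_dist_def by (rule LeastI_ex)
  then obtain q where q: "apath x q y" "length q = graph_dist G x y" by blast
  have least: "graph_dist G x y \<le> length r" if "apath x r y" for r
    unfolding graph_dist_def using that by (auto intro: Least_le)
  have "\<mu> (\<lambda>_. 1) x y \<le> ereal (real (graph_dist G x y))"
    using min_cost_le_walk_cost[of x q y "\<lambda>_. 1"] q by (simp add: cost apath_def)
  moreover have "ereal (real (graph_dist G x y)) \<le> \<mu> (\<lambda>_. 1) x y"
    unfolding \<mu>_def
  proof (rule INF_greatest)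
    fix r assume "r \<in> {p. awalk x p y}"
    then have r: "awalk x r y" by simp
    have nonneg: "0 \<le> awalk_cost (\<lambda>_. 1) w" for w :: "'b list" by (simp add: cost)
    have "awalk_cost (\<lambda>_. 1) (awalk_to_apath r) \<le> awalk_cost (\<lambda>_. 1) r"
      using r nonneg by (intro awalk_to_path_no_neg_cyc_cost) (auto simp: not_less)
    moreover have "graph_dist G x y \<le> length (awalk_to_apath r)"
      using r by (intro least apath_awalk_to_apath)
    ultimately show "ereal (real (graph_dist G x y)) \<le> ereal (awalk_cost (\<lambda>_. 1) r)"
      by (simp add: cost)
  qed
  ultimately show ?thesis by (rule antisym[rotated])
qed

end

theory Submission
  imports Defs
begin

text \<open>
  A shortest path between vertices of different paths passes through \<open>Source\<close> or \<open>Target\<close>, so all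
  distances are explicit. The pair \<open>Source\<close>, \<open>Target\<close> determines the position of a vertex on its path
  and the length of that path; one more vertex separates the two paths of length \<open>p\<close>.
  Conversely, no two vertices resolve the graph. All its cycles are even, so at each of the two
  branch vertices the distance to a fixed vertex changes by \<open>1\<close> or \<open>-1\<close> along each of the three
  arcs. Hence two vertices that separate the three neighbours of \<open>Source\<close> as well as those of
  \<open>Target\<close> lie inside different paths, and the one on the long path, if any, is not adjacent to a
  branch vertex. For such a pair, two vertices with the same distances to it are given explicitly.
\<close>

section \<open>Distances certified by a potential function\<close>

text \<open>Along a walk to \<open>y\<close> the value of \<open>f\<close> falls by at most one per
  arc, which bounds the length from below; following arcs of strict descent gives a walk of length
  at most \<open>f\<close>.\<close>

lemma (in fin_digraph) graph_dist_eqI: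
  assumes x: "x \<in> verts G"
    and zero: "f y = 0"
    and lipschitz: "\<And>e. e \<in> arcs G \<Longrightarrow> f (tail G e) \<le> Suc (f (head G e))"
    and descent: "\<And>z. z \<in> verts G \<Longrightarrow> z \<noteq> y \<Longrightarrow> \<exists>e\<in>arcs G. tail G e = z \<and> f (head G e) < f z"
  shows "graph_dist G x y = f x"
proof -
  have lower: "f z \<le> length q" if "awalk z q y" for z q
    using that
  proof (induction q arbitrary: z)
    case Nil
    then show ?case using zero by (simp add: awalk_Nil_iff)
  next
    case (Cons e q)
    then have "e \<in> arcs G" "tail G e = z" "awalk (head G e) q y"
      by (auto simp: awalk_Cons_iff)
    then show ?case using Cons.IH[of "head G e"] lipschitz[of e] by simp
  qed
  have upper: "\<exists>q. awalk z q y \<and> length q \<le> f z" if "z \<in> verts G" for z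
    using that
  proof (induction "f z" arbitrary: z rule: less_induct)
    case less
    show ?case
    proof (cases "z = y")
      case True
      then have "awalk z [] y" using less.prems by (simp add: awalk_Nil_iff)
      then show ?thesis by fastforce
    next
      case False
      then obtain e where e: "e \<in> arcs G" "tail G e = z" "f (head G e) < f z"
        using descent less.prems by blast
      then obtain q where "awalk (head G e) q y" "length q \<le> f (head G e)"
        using less.hyps[of "head G e"] by auto
      then have "awalk z (e # q) y \<and> length (e # q) \<le> f z"
        using e by (simp add: awalk_Cons_iff)
      then show ?thesis by blast
    qed
  qed
  obtain q where q: "awalk x q y" "length q \<le> f x" using upper[OF x] by blast
  define r where "r = awalk_to_apath q"
  have r: "apath x r y" unfolding r_def using q(1) by (rule apath_awalk_to_apath)
  \<comment> \<open>With unit weights no cycle is negative, so cutting out cycles does not raise the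
    cost, which is the length.\<close>
  have "length r \<le> length q"
  proof -
    have cost: "awalk_cost (\<lambda>_. 1) w = real (length w)" for w :: "'b list"
      by (induction w) auto
    have "awalk_cost (\<lambda>_. 1) (awalk_to_apath q) \<le> awalk_cost (\<lambda>_. 1) q"
      using q(1) by (intro awalk_to_path_no_neg_cyc_cost) (auto simp: cost not_less)
    then show ?thesis by (simp add: cost r_def)
  qed
  with q(2) have "length r \<le> f x" by simp
  moreover have "f x \<le> length r" using lower r by (simp add: apath_def)
  ultimately have "length r = f x" by simp
  show ?thesis unfolding graph_dist_def
  proof (rule Least_equality)
    show "\<exists>q. apath x q y \<and> length q = f x" using r \<open>length r = f x\<close> by blast
    show "f x \<le> n" if "\<exists>q. apath x q y \<and> length q = n" for n
      using that lower by (auto simp: apath_def)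
  qed
qed

section \<open>The explicit distance function\<close>

text \<open>On a path of length \<open>l \<le> p + 2\<close> the subpaths between vertices, other than the whole path, are
  geodesics, so a geodesic between different paths runs through \<open>Source\<close> or through \<open>Target\<close>.\<close>

fun source_dist :: "nat \<Rightarrow> theta_vertex \<Rightarrow> nat" where
  "source_dist p Source = 0"
| "source_dist p Target = p"
| "source_dist p (Inner i k) = k"

definition path_len :: "nat \<Rightarrow> nat \<Rightarrow> nat" where
  "path_len p i = (if i = 1 then p + 2 else p)"

fun target_dist :: "nat \<Rightarrow> theta_vertex \<Rightarrow> nat" where
  "target_dist p Source = p"
| "target_dist p Target = 0"
| "target_dist p (Inner i k) = path_len p i - k"

definition through_ends :: "nat \<Rightarrow> theta_vertex \<Rightarrow> theta_vertex \<Rightarrow> nat" where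
  "through_ends p x y = min (source_dist p x + source_dist p y) (target_dist p x + target_dist p y)"

fun theta_dist :: "nat \<Rightarrow> theta_vertex \<Rightarrow> theta_vertex \<Rightarrow> nat" where
  "theta_dist p (Inner i k) (Inner j m) =
     (if i = j then (k - m) + (m - k) else through_ends p (Inner i k) (Inner j m))"
| "theta_dist p x y = through_ends p x y"

lemma pverts_theta_graph:
  assumes "p > 0"
  shows "pverts (theta_graph p (p + 2) p) = {Source, Target} \<union>
    {Inner i k | i k. i \<le> 2 \<and> 0 < k \<and> k < path_len p i}"
proof -
  have path: "path_verts i l = {Source, Target} \<union> {Inner i k | k. 0 < k \<and> k < l}" if "l > 0" for i l
  proof -
    have "path_verts i l = theta_path i l ` {..l}" by (auto simp: path_verts_def)
    also have "\<dots> = theta_path i l ` ({0, l} \<union> {0<..<l})"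
      using that by (intro arg_cong[where f = "image (theta_path i l)"]) auto
    also have "\<dots> = {Source, Target} \<union> Inner i ` {0<..<l}"
      using that by (auto simp: image_Un theta_path_def)
    finally show ?thesis by auto
  qed
  have i: "{i :: nat. i \<le> 2} = {0, 1, 2}" by auto
  have "pverts (theta_graph p (p + 2) p) = (\<Union>i\<in>{i. i \<le> 2}. path_verts i (path_len p i))"
    unfolding i by (simp add: theta_graph_def path_len_def Un_assoc)
  also have "\<dots> = (\<Union>i\<in>{i. i \<le> 2}. {Source, Target} \<union> {Inner i k | k. 0 < k \<and> k < path_len p i})"
    using assms by (intro SUP_cong refl path) (simp add: path_len_def)
  finally show ?thesis by auto
qed

context
  fixes p :: nat
  assumes p: "p \<ge> 2"
begin

abbreviation "V \<equiv> pverts (theta_graph p (p + 2) p)"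
abbreviation "A \<equiv> parcs (theta_graph p (p + 2) p)"
abbreviation "vertex i k \<equiv> theta_path i (path_len p i) k"

lemma path_len_bounds: "p \<le> path_len p i" "path_len p i \<le> p + 2"
  by (simp_all add: path_len_def)

lemma theta_vertex_cases:
  assumes "x \<in> V"
  obtains (Source) "x = Source" | (Target) "x = Target"
    | (Inner) i k where "x = Inner i k" "i \<le> 2" "0 < k" "k < path_len p i"
  using assms p pverts_theta_graph[of p] by auto

lemma theta_path_cases:
  assumes "x \<in> V" "j \<le> 2"
  obtains i k where "x = vertex i k" "i \<le> 2" "k \<le> path_len p i" "i = j \<or> 0 < k \<and> k < path_len p i"
  using assms(1)
proof (cases x rule: theta_vertex_cases)
  case Source
  then show ?thesis using that[of j 0] assms(2) by (simp add: theta_path_def)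
next
  case Target
  then show ?thesis using that[of j "path_len p j"] p assms(2) path_len_bounds[of j]
    by (simp add: theta_path_def)
next
  case (Inner i k)
  then show ?thesis using that[of i k] by (simp add: theta_path_def)
qed

lemma theta_arcs:
  "A = {(vertex i k, vertex i (Suc k)) | i k. i \<le> 2 \<and> k < path_len p i} \<union>
    {(vertex i (Suc k), vertex i k) | i k. i \<le> 2 \<and> k < path_len p i}"
proof -
  have i: "i \<le> 2 \<longleftrightarrow> i = 0 \<or> i = 1 \<or> i = 2" for i :: nat by auto
  have "A = (\<Union>i\<in>{0, 1, 2}. path_arcs i (path_len p i))"
    by (simp add: theta_graph_def path_len_def Un_assoc)
  also have "{0, 1, 2} = {i :: nat. i \<le> 2}" by (auto simp: i)
  finally show ?thesis by (auto simp: path_arcs_def)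
qed

text \<open>In this and the next three formulas \<open>k\<close> may be an end of the path, so arcs
  at a branch vertex are treated like all others.\<close>

lemma theta_dist_Source:
  "k \<le> path_len p i \<Longrightarrow> theta_dist p (vertex i k) Source = min k (path_len p i - k + p)"
  using path_len_bounds[of i] by (auto simp: theta_path_def through_ends_def)

lemma theta_dist_Target:
  "k \<le> path_len p i \<Longrightarrow> theta_dist p (vertex i k) Target = min (k + p) (path_len p i - k)"
  using path_len_bounds[of i] by (auto simp: theta_path_def through_ends_def)

lemma theta_dist_same_path:
  "k \<le> path_len p i \<Longrightarrow> 0 < m \<Longrightarrow> m < path_len p i \<Longrightarrow>
    theta_dist p (vertex i k) (Inner i m) = (k - m) + (m - k)"
  using path_len_bounds[of i] by (auto simp: theta_path_def through_ends_def)

lemma theta_dist_other_path: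
  "k \<le> path_len p i \<Longrightarrow> 0 < m \<Longrightarrow> m < path_len p j \<Longrightarrow> i \<noteq> j \<Longrightarrow>
    theta_dist p (vertex i k) (Inner j m) = min (k + m) ((path_len p i - k) + (path_len p j - m))"
  using path_len_bounds[of i] path_len_bounds[of j]
  by (auto simp: theta_path_def through_ends_def)

declare theta_dist.simps [simp del]

lemmas theta_dist_path =
  theta_dist_Source theta_dist_Target theta_dist_same_path theta_dist_other_path

text \<open>A step along a path changes each term of the distance formulas by at most one, and
  minima inherit this bound.\<close>

lemma theta_dist_lipschitz:
  assumes "e \<in> A" "y \<in> V"
  shows "theta_dist p (fst e) y \<le> Suc (theta_dist p (snd e) y)"
proof -
  have min_le_Suc_min: "a \<le> Suc b \<Longrightarrow> c \<le> Suc d \<Longrightarrow> min a c \<le> Suc (min b d)" for a b c d :: nat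
    by auto
  have "theta_dist p (vertex i k) y \<le> Suc (theta_dist p (vertex i (Suc k)) y) \<and>
      theta_dist p (vertex i (Suc k)) y \<le> Suc (theta_dist p (vertex i k) y)"
    if "k < path_len p i" for i k
    using assms(2)
  proof (cases y rule: theta_vertex_cases)
    case (Inner j m)
    then show ?thesis using that
      by (cases "i = j") (auto simp: theta_dist_path intro!: min_le_Suc_min)
  qed (use that in \<open>auto simp: theta_dist_path intro!: min_le_Suc_min\<close>)
  then show ?thesis
    using assms(1) unfolding theta_arcs by auto
qed

text \<open>The step goes along a path through \<open>x\<close>, towards \<open>y\<close> if
  \<open>y\<close> lies on it and otherwise towards the end that realises the minimum.\<close>

lemma theta_dist_descent:
  assumes "x \<in> V" "y \<in> V" "x \<noteq> y"
  shows "\<exists>e\<in>A. fst e = x \<and> theta_dist p (snd e) y < theta_dist p x y"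
proof -
  \<comment> \<open>For a branch vertex \<open>y\<close> the default \<open>0\<close> selects a path
    of length \<open>p\<close>. The opposite branch vertex is then placed on a geodesic; from there
    the long path offers no descent.\<close>
  define j where "j = (case y of Inner j m \<Rightarrow> j | _ \<Rightarrow> 0)"
  have "j \<le> 2" using assms(2) by (cases y rule: theta_vertex_cases) (simp_all add: j_def)
  with assms(1) obtain i k where x: "x = vertex i k" "i \<le> 2" "k \<le> path_len p i"
    and ij: "i = j \<or> 0 < k \<and> k < path_len p i"
    by (rule theta_path_cases)
  have down: ?thesis if "0 < k" "theta_dist p (vertex i (k - 1)) y < theta_dist p (vertex i k) y"
  proof -
    have "(vertex i (Suc (k - 1)), vertex i (k - 1)) \<in> A"
      unfolding theta_arcs using x that by fastforce
    then show ?thesis using x that by force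
  qed
  have up: ?thesis if "k < path_len p i" "theta_dist p (vertex i (Suc k)) y < theta_dist p (vertex i k) y"
  proof -
    have "(vertex i k, vertex i (Suc k)) \<in> A"
      unfolding theta_arcs using x that by fastforce
    then show ?thesis using x that by force
  qed
  note len = path_len_bounds[of i]
  have len0: "path_len p 0 = p" by (simp add: path_len_def)
  show ?thesis
    using assms(2)
  proof (cases y rule: theta_vertex_cases)
    case Source
    then have "0 < k" using x assms(3) by (auto simp: theta_path_def intro: Nat.gr0I)
    moreover have "k \<le> path_len p i - k + p"
      using ij x(3) len len0 Source by (auto simp: j_def)
    ultimately show ?thesis using x Source by (intro down) (auto simp: theta_dist_path)
  next
    case Target
    then have "k < path_len p i" using x assms(3) len p
      by (cases "k = path_len p i") (auto simp: theta_path_def)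
    moreover have "path_len p i - k \<le> k + p"
      using ij x(3) len len0 Target by (auto simp: j_def)
    ultimately show ?thesis using x Target by (intro up) (auto simp: theta_dist_path)
  next
    case (Inner j' m)
    then have j': "j' = j" by (simp add: j_def)
    show ?thesis
    proof (cases "i = j")
      case True
      then have "k \<noteq> m" using assms(3) x Inner j' by (auto simp: theta_path_def)
      then consider "k < m" | "m < k" by linarith
      then show ?thesis
      proof cases
        case 1
        then show ?thesis using x Inner j' True by (intro up) (auto simp: theta_dist_path)
      next
        case 2
        then show ?thesis using x Inner j' True by (intro down) (auto simp: theta_dist_path)
      qed
    next
      case False
      then have k: "0 < k" "k < path_len p i" using ij by auto
      show ?thesis
      proof (cases "k + m \<le> (path_len p i - k) + (path_len p j - m)")
        case True
        then show ?thesis using x k Inner j' False by (intro down) (auto simp: theta_dist_path)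
      next
        case nle: False
        then show ?thesis using x k Inner j' False by (intro up) (auto simp: theta_dist_path)
      qed
    qed
  qed
qed

lemma graph_dist_theta_graph:
  assumes "x \<in> V" "y \<in> V"
  shows "graph_dist (with_proj (theta_graph p (p + 2) p)) x y = theta_dist p x y"
proof -
  interpret pair_graph "theta_graph p (p + 2) p" by (rule pair_graph_theta_graph)
  show ?thesis
  proof (rule graph_dist_eqI)
    show "theta_dist p y y = 0"
      using assms(2)
      by (cases y rule: theta_vertex_cases) (simp_all add: theta_dist.simps through_ends_def)
  qed (use assms theta_dist_lipschitz theta_dist_descent in auto)
qed

section \<open>Two vertices never resolve the graph\<close>

definition unresolved :: "theta_vertex \<Rightarrow> theta_vertex \<Rightarrow> bool" where
  "unresolved x y \<longleftrightarrow> (\<exists>u\<in>V. \<exists>v\<in>V. u \<noteq> v \<and>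
    theta_dist p u x = theta_dist p v x \<and> theta_dist p u y = theta_dist p v y)"

lemma unresolved_commute: "unresolved x y \<longleftrightarrow> unresolved y x"
  unfolding unresolved_def by blast

lemma unresolvedI:
  assumes "i \<le> 2" "k \<le> path_len p i" "j \<le> 2" "m \<le> path_len p j" "vertex i k \<noteq> vertex j m"
    and "theta_dist p (vertex i k) x = theta_dist p (vertex j m) x"
    and "theta_dist p (vertex i k) y = theta_dist p (vertex j m) y"
  shows "unresolved x y"
proof -
  have "vertex i k \<in> V" if "i \<le> 2" "k \<le> path_len p i" for i k
    using that p pverts_theta_graph[of p] by (auto simp: theta_path_def)
  then show ?thesis unfolding unresolved_def using assms by metis
qed

lemma path_len_simps: "i \<noteq> 1 \<Longrightarrow> path_len p i = p" "path_len p (Suc 0) = p + 2"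
  by (simp_all add: path_len_def)

lemmas theta_dist_eval = theta_dist.simps through_ends_def path_len_simps theta_path_def

text \<open>Exchanging the two short paths fixes \<open>x\<close> and \<open>y\<close> and swaps the
  neighbours of \<open>Source\<close> on these paths.\<close>

lemma unresolved_not_short:
  assumes "x \<in> V" "y \<in> V" "\<And>i k. x = Inner i k \<Longrightarrow> i = 1" "\<And>i k. y = Inner i k \<Longrightarrow> i = 1"
  shows "unresolved x y"
proof -
  have "theta_dist p (vertex 0 1) z = theta_dist p (vertex 2 1) z"
    if "z \<in> V" "\<And>i k. z = Inner i k \<Longrightarrow> i = 1" for z
    using that(1) by (cases z rule: theta_vertex_cases)
      (use that(2) p in \<open>auto simp: theta_dist_eval\<close>)
  then show ?thesis
    using assms p by (intro unresolvedI[of 0 1 2 1]) (auto simp: path_len_simps theta_path_def)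
qed

context
  fixes i j a :: nat
  assumes ij: "i \<le> 2" "j \<le> 2" "i \<noteq> 1" "j \<noteq> 1" "i \<noteq> j" and a: "0 < a" "a < p"
begin

text \<open>The short paths are \<open>i\<close> and \<open>j\<close>, in either order. The
  neighbours of \<open>Source\<close> on paths \<open>1\<close> and \<open>j\<close> have geodesics
  through \<open>Source\<close> to the inner vertices of path \<open>i\<close>. Both have distance
  \<open>p\<close> to \<open>Inner 1 (p + 1)\<close>, one along path \<open>1\<close>, the other
  through \<open>Target\<close>.\<close>

lemma unresolved_near_source:
  assumes "y = Source \<or> (\<exists>b. y = Inner i b \<and> 0 < b \<and> b < p) \<or> y = Inner 1 (p + 1)"
  shows "unresolved (Inner i a) y"
  using assms ij a p
  by (intro unresolvedI[of 1 1 j 1])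
    (auto simp: theta_dist_eval)

text \<open>The mirror image of the previous argument, with the neighbours of
  \<open>Target\<close>.\<close>

lemma unresolved_near_target:
  assumes "y = Target \<or> y = Inner 1 1"
  shows "unresolved (Inner i a) y"
  using assms ij a p
  by (intro unresolvedI[of 1 "p + 1" j "p - 1"])
    (auto simp: theta_dist_eval)

lemma unresolved_long:
  assumes b: "2 \<le> b" "b \<le> p"
  shows "unresolved (Inner i a) (Inner 1 b)"
proof -
  consider "a + b = p + 1" | "a + b \<le> p" "a < b" | "a + b \<le> p" "b \<le> a"
    | "p + 2 \<le> a + b" "b \<le> a + 1" | "p + 2 \<le> a + b" "a + 2 \<le> b"
    by linarith
  \<comment> \<open>Reversing all paths replaces \<open>a\<close> by \<open>p - a\<close> and \<open>b\<close> by \<open>p + 2 - b\<close>, which exchanges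
    the last two cases with the second and the third one.\<close>
  then show ?thesis
  proof cases
    \<comment> \<open>The given vertices are antipodal on the cycle of length
      \<open>2 * p + 2\<close> formed by paths \<open>i\<close> and \<open>1\<close>, so both
      neighbours of one have distance \<open>p\<close> to the other.\<close>
    case 1
    then show ?thesis using ij a b p
      by (intro unresolvedI[of 1 "b - 1" 1 "b + 1"])
        (auto simp: theta_dist_eval)
  next
    \<comment> \<open>Here and in the next case both witnesses have distances
      \<open>p + 1 - b\<close> and \<open>p + 1 - a\<close>. The one on path \<open>j\<close>
      reaches both given vertices through \<open>Source\<close>; the other lies past one of them and
      reaches the second through \<open>Target\<close>.\<close>
    case 2
    then show ?thesis using ij a b p
      by (intro unresolvedI[of i "p + 1 + a - b" j "p + 1 - a - b"])
        (auto simp: theta_dist_eval)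
  next
    case 3
    then show ?thesis using ij a b p
      by (intro unresolvedI[of 1 "p + 1 + b - a" j "p + 1 - a - b"])
        (auto simp: theta_dist_eval)
  next
    case 4
    then show ?thesis using ij a b p
      by (intro unresolvedI[of i "a + 1 - b" j "2 * p + 1 - a - b"])
        (auto simp: theta_dist_eval)
  next
    case 5
    then show ?thesis using ij a b p
      by (intro unresolvedI[of 1 "b - a - 1" j "2 * p + 1 - a - b"])
        (auto simp: theta_dist_eval)
  qed
qed

lemma unresolved_short:
  assumes b: "a \<le> b" "b < p"
  shows "unresolved (Inner i a) (Inner j b)"
proof -
  consider "a = b" | "a < b" "a + b = p" | "a < b" "a + b < p" | "a < b" "p < a + b"
    using b by linarith
  then show ?thesis
  proof cases
    \<comment> \<open>Both witnesses have distance \<open>p\<close> to both given vertices, one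
      through \<open>Source\<close>, the other through \<open>Target\<close>.\<close>
    case 1
    then show ?thesis using ij a b p
      by (intro unresolvedI[of 1 "p - a" 1 "p + 2 - a"])
        (auto simp: theta_dist_eval)
  next
    \<comment> \<open>The given vertices are antipodal on the cycle of length \<open>2 * p\<close>
      formed by the short paths; the witnesses are mirror images in the axis through them.\<close>
    case 2
    then show ?thesis using ij a b p
      by (intro unresolvedI[of i 0 i "2 * a"])
        (auto simp: theta_dist_eval)
  next
    \<comment> \<open>Both witnesses have distances \<open>p - b\<close> and \<open>p - a\<close>:
      the one on path \<open>1\<close> through \<open>Source\<close>, the one on path
      \<open>i\<close> directly and through \<open>Target\<close>.\<close>
    case 3
    then show ?thesis using ij a b p
      by (intro unresolvedI[of i "p + a - b" 1 "p - a - b"])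
        (auto simp: theta_dist_eval)
  next
    \<comment> \<open>The preceding case after reversing all paths and exchanging the two given
      vertices.\<close>
    case 4
    then show ?thesis using ij a b p
      by (intro unresolvedI[of 1 "2 * p + 2 - a - b" j "b - a"])
        (auto simp: theta_dist_eval)
  qed
qed

end

lemma unresolved_pair:
  assumes "x \<in> V" "y \<in> V"
  shows "unresolved x y"
proof -
  have short: "unresolved (Inner i a) y"
    if x: "i \<le> 2" "i \<noteq> 1" "0 < a" "a < p" and y: "y \<in> V" for i a y
  proof -
    \<comment> \<open>Since \<open>i\<close> is \<open>0\<close> or \<open>2\<close>, this is the
      other short path.\<close>
    define j where "j = 2 - i"
    have j: "j \<le> 2" "j \<noteq> 1" "i \<noteq> j" using x by (auto simp: j_def)
    from y show ?thesis
    proof (cases y rule: theta_vertex_cases)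
      case Source
      then show ?thesis using unresolved_near_source[of i j a] x j by simp
    next
      case Target
      then show ?thesis using unresolved_near_target[of i j a] x j by simp
    next
      case (Inner i' b)
      consider "i' = i" | "i' = j" | "i' = 1" using x Inner j j_def by linarith
      then show ?thesis
      proof cases
        case 1
        then show ?thesis using unresolved_near_source[of i j a y] x j Inner by (simp add: path_len_simps)
      next
        case 2
        then show ?thesis
          using unresolved_short[of i j a b] unresolved_short[of j i b a] x j Inner
            unresolved_commute[of "Inner i a" y]
          by (cases "a \<le> b") (simp_all add: path_len_simps)
      next
        case 3
        then have "0 < b" "b < p + 2" using Inner by (simp_all add: path_len_simps)
        then consider "b = 1" | "2 \<le> b" "b \<le> p" | "b = p + 1" by linarith
        then show ?thesis
        proof cases
          case 1
          then show ?thesis using unresolved_near_target[of i j a y] x j Inner 3 by simp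
        next
          case 2
          then show ?thesis using unresolved_long[of i j a b] x j Inner 3 by simp
        next
          case last: 3
          then show ?thesis using unresolved_near_source[of i j a y] x j Inner 3 by simp
        qed
      qed
    qed
  qed
  have inner: "i \<le> 2 \<and> 0 < k \<and> k < path_len p i" if "Inner i k \<in> V" for i k
    using that by (cases rule: theta_vertex_cases) auto
  show ?thesis
  proof (cases "(\<exists>i k. x = Inner i k \<and> i \<noteq> 1) \<or> (\<exists>i k. y = Inner i k \<and> i \<noteq> 1)")
    case True
    then show ?thesis
    proof (elim disjE exE conjE)
      fix i k assume "x = Inner i k" "i \<noteq> 1"
      then show ?thesis using short[of i k y] inner[of i k] assms by (simp add: path_len_simps)
    next
      fix i k assume "y = Inner i k" "i \<noteq> 1"
      then show ?thesis using short[of i k x] inner[of i k] assms unresolved_commute[of x y]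
        by (simp add: path_len_simps)
    qed
  next
    case False
    then show ?thesis using assms by (intro unresolved_not_short) auto
  qed
qed

section \<open>Three vertices that resolve the graph\<close>

lemma theta_dist_determines:
  assumes "u \<in> V" "v \<in> V"
    and "theta_dist p u Source = theta_dist p v Source"
    and "theta_dist p u Target = theta_dist p v Target"
    and "theta_dist p u (Inner 0 1) = theta_dist p v (Inner 0 1)"
  shows "u = v"
  using assms(1)
proof (cases u rule: theta_vertex_cases)
  case Source
  show ?thesis using assms(2)
    by (cases rule: theta_vertex_cases)
      (use Source assms(3) p path_len_bounds in \<open>auto simp: theta_dist_eval min_def split: if_splits\<close>)
next
  case Target
  show ?thesis using assms(2)
    by (cases rule: theta_vertex_cases)
      (use Target assms(4) p path_len_bounds in \<open>auto simp: theta_dist_eval min_def split: if_splits\<close>)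
next
  case (Inner i k)
  note u = this
  from assms(2) show ?thesis
  proof (cases v rule: theta_vertex_cases)
    case Source
    then show ?thesis using u assms(3) p path_len_bounds[of i] by (auto simp: theta_dist_eval)
  next
    case Target
    then show ?thesis using u assms(4) p path_len_bounds[of i] by (auto simp: theta_dist_eval)
  next
    case (Inner j m)
    have "k = m"
      using u Inner assms(3) path_len_bounds[of i] path_len_bounds[of j] by (simp add: theta_dist_eval)
    moreover from this have "path_len p i = path_len p j"
      using u Inner assms(4) path_len_bounds[of i] path_len_bounds[of j]
      by (simp add: theta_dist_eval min_def split: if_splits)
    then have "i = j \<or> {i, j} = {0, 2}" using u Inner
      by (auto simp: path_len_def split: if_splits)
    \<comment> \<open>The distance to \<open>Inner 0 1\<close> is \<open>k - 1\<close> from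
      \<open>Inner 0 k\<close> and larger from \<open>Inner 2 k\<close>.\<close>
    then have "i = j" using u Inner \<open>k = m\<close> assms(5) p
      by (auto simp: theta_dist_eval doubleton_eq_iff)
    ultimately show ?thesis using u Inner by simp
  qed
qed

end

theorem corollary1:
  fixes p :: nat
  assumes "p \<ge> 2"
  shows "metric_dimension (with_proj (theta_graph p (p + 2) p)) = 3"
proof -
  let ?G = "with_proj (theta_graph p (p + 2) p)"
  note dist = graph_dist_theta_graph[OF assms]
  have basis: "{Source, Target, Inner 0 1} \<subseteq> verts ?G"
    using assms pverts_theta_graph[of p] by (auto simp: path_len_def)
  have "inj_on (representation ?G [Source, Target, Inner 0 1]) (verts ?G)"
  proof (rule inj_onI)
    fix u v assume "u \<in> verts ?G" "v \<in> verts ?G"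
      and "representation ?G [Source, Target, Inner 0 1] u =
        representation ?G [Source, Target, Inner 0 1] v"
    then show "u = v"
      using basis by (intro theta_dist_determines[OF assms]) (simp_all add: representation_def dist del: add_2_eq_Suc')
  qed
  then have "resolving_set ?G [Source, Target, Inner 0 1]"
    using basis by (simp add: resolving_set_def)
  then have upper: "\<exists>ws. resolving_set ?G ws \<and> length ws = 3"
    by (intro exI[of _ "[Source, Target, Inner 0 1]"]) simp
  have lower: "3 \<le> length ws" if ws: "resolving_set ?G ws" for ws
  proof (rule ccontr)
    assume "\<not> 3 \<le> length ws"
    then have "length ws = 0 \<or> length ws = 1 \<or> length ws = 2" by linarith
    \<comment> \<open>Shorter lists are padded to a pair, possibly with \<open>x = y\<close>, a case
      that \<open>unresolved_pair\<close> includes.\<close>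
    then have "\<exists>x y. set ws \<subseteq> {x, y} \<and> {x, y} \<subseteq> verts ?G"
    proof (elim disjE)
      assume "length ws = 0"
      then show ?thesis using basis by auto
    next
      assume "length ws = 1"
      then obtain x where "ws = [x]" by (auto simp: length_Suc_conv)
      then show ?thesis using ws by (intro exI[of _ x]) (simp add: resolving_set_def)
    next
      assume "length ws = 2"
      then obtain x y where "ws = [x, y]" by (auto simp: length_Suc_conv numeral_2_eq_2)
      then show ?thesis using ws by (intro exI[of _ x] exI[of _ y]) (simp add: resolving_set_def)
    qed
    then obtain x y where xy: "set ws \<subseteq> {x, y}" "x \<in> verts ?G" "y \<in> verts ?G" by auto
    then obtain u v where uv: "u \<in> verts ?G" "v \<in> verts ?G" "u \<noteq> v"
      and same: "theta_dist p u x = theta_dist p v x" "theta_dist p u y = theta_dist p v y"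
      using unresolved_pair[OF assms, of x y] unfolding unresolved_def[OF assms] by auto
    have "graph_dist ?G u w = graph_dist ?G v w" if "w \<in> set ws" for w
      using that xy uv same dist by auto
    then have "representation ?G ws u = representation ?G ws v"
      by (simp add: representation_def)
    then show False using ws uv by (auto simp: resolving_set_def dest: inj_onD)
  qed
  show ?thesis
    unfolding metric_dimension_def
    using upper lower by (intro Least_equality) auto
qed

end
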